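(* Let $0\le\sigma<1/2$. There exists a constant $C_\sigma>0$, depending only on $\sigma$, such that $$ C_\sigma^{-1}\le \mathbf{E}\,\sup_{N\ge2}\ \sup_{t\in\mathbb{R}}\ \frac{\big|\sum_{n=2}^N\varepsilon_n n^{-\sigma-it}\big|}{N^{1-\sigma}(\log N)^{-1}}\le C_\sigma , $$ where the first supremum is over all integers $N\ge 2$.
   Context: $(\varepsilon_n)_{n\ge1}$ is a sequence of independent Rademacher random variables ($\mathbf{P}\{\varepsilon_n=1\}=\mathbf{P}\{\varepsilon_n=-1\}=1/2$), and $\mathbf{E}$ denotes expectation. *)

theory Defs
  imports "HOL-Probability.Probability"
begin

definition rademacher_seq :: "'a measure \<Rightarrow> (nat \<Rightarrow> 'a \<Rightarrow> real) \<Rightarrow> bool" where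
  "rademacher_seq M \<epsilon> \<longleftrightarrow>
     prob_space M \<and>
     prob_space.indep_vars M (\<lambda>_. borel) \<epsilon> {1..} \<and>
     (\<forall>n\<ge>1. measure M {\<omega> \<in> space M. \<epsilon> n \<omega> = 1} = 1 / 2 \<and>
             measure M {\<omega> \<in> space M. \<epsilon> n \<omega> = -1} = 1 / 2)"

definition dirichlet_poly :: "real \<Rightarrow> (nat \<Rightarrow> real) \<Rightarrow> nat \<Rightarrow> real \<Rightarrow> complex" where
  "dirichlet_poly \<sigma> a N t =
     (\<Sum>n=2..N. of_real (a n) * of_nat n powr (- of_real \<sigma> - \<i> * of_real t))"

text \<open>The suprema are taken in \<^typ>\<open>ennreal\<close>, so that an unbounded family has supremum
  \<open>\<infinity>\<close> and no boundedness or integrability is presupposed.\<close>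

definition sup_ratio :: "real \<Rightarrow> (nat \<Rightarrow> real) \<Rightarrow> ennreal" where
  "sup_ratio \<sigma> a =
     (SUP N\<in>{2..}. SUP t. ennreal (cmod (dirichlet_poly \<sigma> a N t) /
        (real N powr (1 - \<sigma>) * inverse (ln (real N)))))"

end

theory Submission
  imports Defs "HOL-Computational_Algebra.Primes"
begin

text \<open>The lower bound comes from \<open>N = 2\<close> alone. For the upper bound, every \<open>n \<le> N\<close> factors as
  \<open>n = u * a * b\<close> with \<open>u\<close> equal to \<open>1\<close> or a prime and \<open>a, b\<close> of size \<open>O(N powr (1/2))\<close>. Grouping
  the sum by \<open>u\<close> and discarding the unimodular factor belonging to \<open>u\<close> leaves sums that depend on
  \<open>t\<close> only through the numbers \<open>m\<close> to the power \<open>-it\<close> with \<open>m = O(N powr (1/2))\<close>; rounding these to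
  \<open>N\<close>-th roots of unity costs a net of logarithmic cardinality \<open>O(N powr (1/2) * ln N)\<close>. For a fixed
  point of the net the group of \<open>u\<close> has variance \<open>O(N powr (1 - 2 * \<sigma>) / u)\<close>, so by Chebyshev's bound
  for the number of primes the expected total of the absolute values of the groups is
  \<open>O(N powr (1 - \<sigma>) / ln N)\<close>. An exponential moment with parameter \<open>N powr (3/4)\<close>, which dominates
  the logarithmic size of the net, makes the exceedance probabilities summable over all \<open>N\<close>, so that no
  separate treatment of the supremum over \<open>N\<close> is needed.\<close>

section \<open>Primes and power sums\<close>

lemma prod_primes_dvd:
  fixes x :: nat
  assumes "finite A" "\<And>p. p \<in> A \<Longrightarrow> prime p" "\<And>p. p \<in> A \<Longrightarrow> p dvd x"
  shows "\<Prod>A dvd x"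
  using assms
proof (induction A rule: finite_induct)
  case (insert p A)
  have "coprime p (\<Prod>A)"
    using insert by (intro prod_coprime_right) (metis insertCI primes_coprime)
  then show ?case
    using insert by (simp add: divides_mult)
qed auto

text \<open>The coefficients at \<open>m\<close> and \<open>m + 1\<close> are equal by symmetry, and
  together they are at most the row sum \<open>2 * 4 ^ m\<close>.\<close>

lemma choose_odd_middle_le: "(2 * m + 1) choose m \<le> 4 ^ m"
proof -
  have "2 * ((2 * m + 1) choose m) = (\<Sum>k\<in>{m, m + 1}. (2 * m + 1) choose k)"
    using binomial_symmetric[of m "2 * m + 1"] by simp
  also have "\<dots> \<le> (\<Sum>k\<le>2 * m + 1. (2 * m + 1) choose k)"
    by (intro sum_mono2) auto
  also have "\<dots> = 2 * 4 ^ m"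
    by (simp only: choose_row_sum power_add power_mult) simp
  finally show ?thesis by simp
qed

text \<open>Erdos's argument by strong induction. An even \<open>n > 2\<close> is not prime, so
  \<open>n - 1\<close> gives the same product. For \<open>n = 2 * m + 1\<close> the primes up to
  \<open>m + 1\<close> are covered by the induction hypothesis; each prime in the remaining range
  divides \<open>fact n\<close> but neither \<open>fact m\<close> nor \<open>fact (m + 1)\<close>,
  so the product of these primes divides \<open>n choose m\<close>, which is at most
  \<open>4 ^ m\<close>.\<close>

lemma primorial_le: "\<Prod>{p::nat. prime p \<and> p \<le> n} \<le> 4 ^ n"
proof (induction n rule: less_induct)
  case (less n)
  consider "n \<le> 2" | "n > 2" "even n" | "n > 2" "odd n" by linarith
  then show ?case
  proof cases
    case 1
    have "{p::nat. prime p \<and> p \<le> n} \<subseteq> {2}"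
      using 1 by (auto dest: prime_ge_2_nat)
    then consider "{p::nat. prime p \<and> p \<le> n} = {}" | "{p::nat. prime p \<and> p \<le> n} = {2}"
      by blast
    then show ?thesis
    proof cases
      assume "{p::nat. prime p \<and> p \<le> n} = {}"
      then show ?thesis by (simp only: prod.empty) simp
    next
      assume *: "{p::nat. prime p \<and> p \<le> n} = {2}"
      then have "2 \<in> {p::nat. prime p \<and> p \<le> n}" by simp
      then have "n = 2" using 1 by simp
      then show ?thesis using * by simp
    qed
  next
    case 2
    have "{p::nat. prime p \<and> p \<le> n} = {p. prime p \<and> p \<le> n - 1}"
      using 2 by (auto simp: le_less prime_nat_iff)
    then have "\<Prod>{p::nat. prime p \<and> p \<le> n} \<le> 4 ^ (n - 1)"
      using less[of "n - 1"] 2 by simp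
    also have "\<dots> \<le> 4 ^ n" by (intro power_increasing) auto
    finally show ?thesis .
  next
    case 3
    then obtain m where m: "n = 2 * m + 1" by (elim oddE)
    let ?A = "{p::nat. prime p \<and> p \<le> m + 1}" and ?B = "{p::nat. prime p \<and> m + 1 < p \<and> p \<le> n}"
    have "?B \<subseteq> {..n}" by auto
    then have fin: "finite ?B" by (rule finite_subset) simp
    have "p dvd (n choose m)" if "p \<in> ?B" for p
    proof -
      have "fact m * fact (n - m) * (n choose m) = (fact n :: nat)"
        using m by (intro binomial_fact_lemma) simp
      moreover have "p dvd fact n" "\<not> p dvd fact m" "\<not> p dvd fact (n - m)"
        using that m unfolding prime_dvd_fact_iff[of p, OF that[THEN CollectD, THEN conjunct1]] by auto
      ultimately show ?thesis
        using that by (metis (no_types, lifting) mem_Collect_eq prime_dvd_mult_iff)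
    qed
    then have "\<Prod>?B dvd (n choose m)"
      using fin by (intro prod_primes_dvd) auto
    then have "\<Prod>?B \<le> (n choose m)"
      by (rule dvd_imp_le) (use m in simp)
    also have "\<dots> \<le> 4 ^ m" using choose_odd_middle_le[of m] m by simp
    finally have B: "\<Prod>?B \<le> 4 ^ m" .
    have "{p::nat. prime p \<and> p \<le> n} = ?A \<union> ?B" using m by auto
    moreover have "\<Prod>(?A \<union> ?B) = \<Prod>?A * \<Prod>?B"
      using fin by (intro prod.union_disjoint) auto
    ultimately have "\<Prod>{p::nat. prime p \<and> p \<le> n} = \<Prod>?A * \<Prod>?B" by simp
    also have "\<dots> \<le> 4 ^ (m + 1) * 4 ^ m"
      using less[of "m + 1"] B 3 m by (intro mult_mono) auto
    also have "\<dots> = 4 ^ n" using m by (simp flip: power_add mult_2)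
    finally show ?thesis .
  qed
qed

lemma sum_ln_primes_le: "(\<Sum>p | prime p \<and> p \<le> n. ln (real p)) \<le> real n * ln 4"
proof -
  have fin: "finite {p::nat. prime p \<and> p \<le> n}"
    by (rule finite_subset[of _ "{..n}"]) auto
  have "(\<Sum>p | prime p \<and> p \<le> n. ln (real p)) = ln (\<Prod>p | prime p \<and> p \<le> n. real p)"
    using fin by (intro ln_prod[symmetric]) (auto simp: prime_gt_0_nat)
  also have "\<dots> = ln (real (\<Prod>{p::nat. prime p \<and> p \<le> n}))" by simp
  also have "\<dots> \<le> ln (real (4 ^ n))"
    using primorial_le[of n] by (intro ln_mono) (auto intro!: prod_pos simp: prime_gt_0_nat simp del: of_nat_power of_nat_prod)
  also have "\<dots> = real n * ln 4" by (simp add: ln_realpow)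
  finally show ?thesis .
qed

text \<open>Summation by parts in inductive form: as the partial sums are nonpositive, replacing the
  weight \<open>f n\<close> by the smaller \<open>f (Suc n)\<close> can only increase the
  product.\<close>

lemma sum_mult_antimono_le:
  fixes a f :: "nat \<Rightarrow> real"
  assumes nonpos: "\<And>n. (\<Sum>k=1..n. a k) \<le> 0"
    and dec: "\<And>k. k \<ge> 1 \<Longrightarrow> f (Suc k) \<le> f k"
    and n: "n \<ge> 1"
  shows "(\<Sum>k=1..n. a k * f k) \<le> (\<Sum>k=1..n. a k) * f n"
  using n
proof (induction n rule: dec_induct)
  case (step n)
  have "(\<Sum>k=1..Suc n. a k * f k) \<le> (\<Sum>k=1..n. a k) * f n + a (Suc n) * f (Suc n)"
    using step by simp
  also have "(\<Sum>k=1..n. a k) * f n \<le> (\<Sum>k=1..n. a k) * f (Suc n)"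
    using nonpos dec step by (intro mult_left_mono_neg) auto
  finally show ?case by (simp add: algebra_simps)
qed simp

text \<open>By the mean value theorem each term is at most the increment of
  \<open>x powr (1 - s) / (1 - s)\<close> over the preceding unit interval, and the increments
  telescope.\<close>

lemma sum_powr_le:
  fixes s :: real
  assumes "0 \<le> s" "s < 1"
  shows "(\<Sum>k=1..n. real k powr (-s)) \<le> real n powr (1 - s) / (1 - s)"
proof (induction n)
  case (Suc n)
  have "real (Suc n) powr (-s) \<le> (real (Suc n) powr (1 - s) - real n powr (1 - s)) / (1 - s)"
  proof (cases "n = 0")
    case False
    have "\<exists>z>real n. z < real (Suc n) \<and>
      real (Suc n) powr (1 - s) - real n powr (1 - s) = (real (Suc n) - real n) * ((1 - s) * z powr (1 - s - 1))"
      using False has_real_derivative_powr[where r = "1 - s"] by (intro MVT2) auto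
    then obtain z where z: "z > real n" "z < real (Suc n)"
      "real (Suc n) powr (1 - s) - real n powr (1 - s) = (1 - s) * z powr (-s)"
      by auto
    have "real (Suc n) powr (-s) \<le> z powr (-s)"
      using z assms False by (intro powr_mono2') auto
    then show ?thesis using z(3) assms by simp
  qed (use assms in \<open>simp add: field_simps\<close>)
  then show ?case using Suc assms by (simp add: diff_divide_distrib)
qed (use assms in simp)

lemma ln_le_powr:
  fixes x c :: real
  assumes "x \<ge> 1" "c > 0"
  shows "ln x \<le> x powr c / c"
proof -
  have "c * ln x = ln (x powr c)" using assms by (simp add: ln_powr)
  also have "\<dots> \<le> x powr c" using assms by (intro ln_bound) auto
  finally show ?thesis using assms by (simp add: field_simps)
qed

text \<open>The saving of \<open>ln N\<close> over the sum over all integers comes from the weights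
  \<open>ln p\<close>: if \<open>p\<^sup>2 > N\<close>, then \<open>ln N\<close> is at most
  \<open>2 * ln p\<close>, and Chebyshev's bound passes to the weight \<open>p powr (-1/2)\<close>
  by partial summation. The primes with \<open>p\<^sup>2 \<le> N\<close> are so few that the trivial
  bound of order \<open>N powr (1/4)\<close> suffices, even after multiplication by
  \<open>ln N\<close>. The two contributions are \<open>12 * sqrt N\<close> and
  \<open>8 * sqrt N\<close>.\<close>

lemma sum_inverse_sqrt_primes_le:
  assumes "N \<ge> 2"
  shows "(\<Sum>p | prime p \<and> p \<le> N. real p powr (-1/2)) \<le> 20 * sqrt (real N) / ln (real N)"
proof -
  let ?P = "{p::nat. prime p \<and> p \<le> N}"
  define f where "f k = real k powr (-1/2)" for k
  have fin: "finite ?P" by (rule finite_subset[of _ "{..N}"]) auto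
  have lnN: "ln (real N) > 0" using assms by simp
  have f0: "f k \<ge> 0" for k by (simp add: f_def)
  have filt: "(\<Sum>k=1..n. if prime k then h k else 0) = (\<Sum>p | prime p \<and> p \<le> n. h p)" for n and h :: "nat \<Rightarrow> real"
  proof -
    have "{k \<in> {1..n}. prime k} = {p. prime p \<and> p \<le> n}" using prime_ge_1_nat by auto
    then show ?thesis by (simp add: sum.inter_filter[symmetric])
  qed
  \<comment> \<open>Subtracting the constant \<open>ln 4\<close> turns Chebyshev's bound into
    nonpositivity of all partial sums, the form that the partial summation requires.\<close>
  define a where "a k = (if prime k then ln (real k) else 0) - ln 4" for k :: nat
  have aneg: "(\<Sum>k=1..n. a k) \<le> 0" for n
    using sum_ln_primes_le[of n] by (simp add: a_def sum_subtractf filt del: One_nat_def)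
  have fdec: "f (Suc k) \<le> f k" if "k \<ge> 1" for k
    unfolding f_def using that by (intro powr_mono2') auto
  have sumf: "(\<Sum>k=1..n. f k) \<le> 2 * sqrt (real n)" for n
    using sum_powr_le[of "1/2" n] by (simp add: f_def powr_half_sqrt)
  have ln4: "ln (4::real) \<le> 3" using ln_le_minus_one[of "4::real"] by simp
  have "(\<Sum>k=1..N. a k * f k) \<le> 0"
    using sum_mult_antimono_le[of a f N, OF aneg fdec] aneg[of N] f0[of N] assms
      mult_nonpos_nonneg[of "\<Sum>k=1..N. a k" "f N"] by linarith
  moreover have "(\<Sum>k=1..N. a k * f k) = (\<Sum>k=1..N. if prime k then ln (real k) * f k else 0) - ln 4 * (\<Sum>k=1..N. f k)"
    unfolding sum_distrib_left sum_subtractf[symmetric] by (intro sum.cong) (auto simp: a_def algebra_simps)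
  ultimately have "(\<Sum>p\<in>?P. ln (real p) * f p) \<le> ln 4 * (\<Sum>k=1..N. f k)"
    unfolding filt by simp
  also have "\<dots> \<le> 3 * (2 * sqrt (real N))"
    using ln4 sumf by (intro mult_mono) (auto intro!: sum_nonneg f0)
  finally have A: "(\<Sum>p\<in>?P. ln (real p) * f p) \<le> 6 * sqrt (real N)" by simp
  define Q where "Q = {p \<in> ?P. p\<^sup>2 \<le> N}"
  define r where "r = nat \<lfloor>sqrt (real N)\<rfloor>"
  have r: "real r \<le> sqrt (real N)" by (simp add: r_def)
  have "Q \<subseteq> {1..r}"
  proof
    fix p assume p: "p \<in> Q"
    then have "real p ^ 2 \<le> real N" by (simp add: Q_def flip: of_nat_power)
    then have "real p \<le> sqrt (real N)" by (simp add: real_le_rsqrt)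
    then have "p \<le> r" by (simp add: r_def le_nat_floor)
    then show "p \<in> {1..r}" using p by (auto simp: Q_def dest: prime_ge_1_nat)
  qed
  then have "(\<Sum>p\<in>Q. f p) \<le> (\<Sum>k=1..r. f k)"
    using f0 by (intro sum_mono2) auto
  also have "\<dots> \<le> 2 * sqrt (real r)" by (rule sumf)
  also have "\<dots> \<le> 2 * sqrt (sqrt (real N))" using r by simp
  finally have B: "(\<Sum>p\<in>Q. f p) \<le> 2 * sqrt (sqrt (real N))" .
  have ln_N: "ln (real N) \<le> 4 * sqrt (sqrt (real N))"
    using ln_le_powr[of "real N" "1/4"] assms by (simp add: powr_powr flip: powr_half_sqrt)
  have Q_sum: "ln (real N) * (\<Sum>p\<in>Q. f p) = (\<Sum>p\<in>?P. if p\<^sup>2 \<le> N then ln (real N) * f p else 0)"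
    unfolding sum_distrib_left Q_def by (rule sum.inter_filter[OF fin])
  have "ln (real N) * (\<Sum>p\<in>?P. f p) = (\<Sum>p\<in>?P. ln (real N) * f p)"
    by (simp add: sum_distrib_left)
  also have "\<dots> \<le> (\<Sum>p\<in>?P. 2 * (ln (real p) * f p) + (if p\<^sup>2 \<le> N then ln (real N) * f p else 0))"
  proof (rule sum_mono)
    fix p assume "p \<in> ?P"
    then have p: "p \<ge> 2" by (auto dest: prime_ge_2_nat)
    show "ln (real N) * f p \<le> 2 * (ln (real p) * f p) + (if p\<^sup>2 \<le> N then ln (real N) * f p else 0)"
    proof (cases "p\<^sup>2 \<le> N")
      case True
      then show ?thesis using f0[of p] p by simp
    next
      case False
      then have "real N \<le> real p ^ 2" by (simp flip: of_nat_power)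
      then have "ln (real N) \<le> ln (real p ^ 2)" using assms p by (intro ln_mono) auto
      also have "\<dots> = 2 * ln (real p)" using p by (simp add: ln_realpow)
      finally have "ln (real N) * f p \<le> 2 * ln (real p) * f p"
        by (intro mult_right_mono f0)
      then show ?thesis using False by simp
    qed
  qed
  also have "\<dots> = 2 * (\<Sum>p\<in>?P. ln (real p) * f p) + ln (real N) * (\<Sum>p\<in>Q. f p)"
    unfolding Q_sum by (simp add: sum.distrib sum_distrib_left)
  also have "\<dots> \<le> 2 * (6 * sqrt (real N)) + (4 * sqrt (sqrt (real N))) * (2 * sqrt (sqrt (real N)))"
    using A B ln_N lnN by (intro add_mono mult_left_mono mult_mono) (auto intro!: sum_nonneg f0)
  also have "\<dots> = 20 * sqrt (real N)" by simp
  finally show ?thesis using lnN by (simp add: f_def field_simps)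
qed

section \<open>Factorization into a prime and two small factors\<close>

lemma prime_times_two_small_factors:
  fixes n N Y :: nat
  assumes n: "1 \<le> n" "n \<le> N" and Y: "N \<le> Y\<^sup>2"
  obtains u a b where "n = u * a * b" "u = 1 \<or> prime u" "1 \<le> u" "u \<le> N" "1 \<le> a" "a \<le> Y" "1 \<le> b" "b \<le> Y"
proof -
  have Ypos: "Y \<ge> 1" using n Y by (cases Y) auto
  define D where "D = {d. d dvd n \<and> d \<le> Y}"
  have finD: "finite D" by (rule finite_subset[of _ "{..Y}"]) (auto simp: D_def)
  have "1 \<in> D" using Ypos by (simp add: D_def)
  \<comment> \<open>if the cofactor of the largest divisor \<open>a \<le> Y\<close> exceeds \<open>Y\<close>, then moving any prime from it
    to \<open>a\<close> brings it below \<open>Y\<close>\<close>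
  define a where "a = Max D"
  have aD: "a \<in> D" unfolding a_def using finD \<open>1 \<in> D\<close> by (intro Max_in) auto
  have amax: "d \<le> a" if "d \<in> D" for d unfolding a_def using finD that by simp
  have a1: "a \<ge> 1" using amax[OF \<open>1 \<in> D\<close>] .
  from aD obtain c where c: "n = a * c" by (auto simp: D_def)
  have c1: "c \<ge> 1" using c n by (cases c) auto
  show thesis
  proof (cases "c \<le> Y")
    case True
    show thesis by (rule that[of 1 a c]) (use c a1 aD c1 True n in \<open>simp_all add: D_def del: One_nat_def\<close>)
  next
    case False
    then have "c \<noteq> 1" using Ypos by auto
    then obtain p where p: "prime p" "p dvd c" using prime_factor_nat by blast
    then obtain b where b: "c = p * b" by auto
    have b1: "b \<ge> 1" using b c1 by (cases b) auto
    have p1: "p \<ge> 2" using p prime_ge_2_nat by blast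
    have "a * p dvd n" using c b by auto
    moreover have "a * p > a" using a1 p1 by simp
    ultimately have "a * p > Y" using amax[of "a * p"] by (force simp: D_def)
    have "b \<le> Y"
    proof (rule ccontr)
      assume "\<not> b \<le> Y"
      then have "Y * Y < (a * p) * b" using \<open>a * p > Y\<close> a1 p1 by (intro mult_strict_mono) auto
      then show False using c b n Y by (simp add: power2_eq_square mult.assoc)
    qed
    moreover have "p \<le> N" using \<open>a * p dvd n\<close> n by (meson dvd_imp_le dvd_mult_right le_trans less_le_trans zero_less_one)
    ultimately show thesis
      by (intro that[of p a b]) (use c b p p1 a1 b1 aD in \<open>auto simp: D_def\<close>)
  qed
qed

section \<open>Exponential moments of Rademacher sums\<close>

lemma cosh_le_exp_square:
  fixes x :: real
  shows "cosh x \<le> exp (x\<^sup>2 / 2)"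
proof -
  have *: "cosh y \<le> exp (y\<^sup>2 / 2)" if "y \<ge> 0" for y :: real
  proof -
    \<comment> \<open>Hoeffding's inequality for a two-point variable, with probability
      \<open>1 / 2\<close> and range \<open>2 * y\<close>: the left side is
      \<open>ln (cosh y)\<close> and the right side is \<open>y\<^sup>2 / 2\<close>.\<close>
    have "- (2 * y) * (1 / 2) + ln (1 + 1 / 2 * (exp (2 * y) - 1)) \<le> (2 * y)\<^sup>2 / 8"
      using that by (intro Hoeffdings_lemma_aux) auto
    moreover have "1 + 1 / 2 * (exp (2 * y) - 1) = exp y * cosh y"
      by (simp add: cosh_def field_simps flip: exp_add)
    ultimately have "ln (cosh y) \<le> y\<^sup>2 / 2"
      by (simp add: ln_mult cosh_real_pos power_mult_distrib)
    then show ?thesis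
      by (metis cosh_real_pos exp_le_cancel_iff exp_ln)
  qed
  show ?thesis using *[of x] *[of "-x"] by (cases "x \<ge> 0") auto
qed

locale rademacher_space = prob_space M for M :: "'a measure" +
  fixes \<epsilon> :: "nat \<Rightarrow> 'a \<Rightarrow> real"
  assumes rademacher: "rademacher_seq M \<epsilon>"
begin

lemma indep: "indep_vars (\<lambda>_. borel) \<epsilon> {1..}"
  using rademacher by (simp add: rademacher_seq_def)

lemma measurable_rademacher [measurable]: "n \<ge> 1 \<Longrightarrow> \<epsilon> n \<in> borel_measurable M"
  using indep by (auto simp: indep_vars_def)

lemma AE_rademacher:
  assumes "n \<ge> 1"
  shows "AE \<omega> in M. \<epsilon> n \<omega> = 1 \<or> \<epsilon> n \<omega> = -1"
proof -
  let ?A = "{\<omega> \<in> space M. \<epsilon> n \<omega> = 1}" and ?B = "{\<omega> \<in> space M. \<epsilon> n \<omega> = -1}"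
  have [measurable]: "?A \<in> events" "?B \<in> events"
    using measurable_rademacher[OF assms] by measurable
  have "prob (?A \<union> ?B) = prob ?A + prob ?B"
    by (intro finite_measure_Union) auto
  also have "\<dots> = 1"
    using rademacher assms by (simp only: rademacher_seq_def)
  finally have "AE \<omega> in M. \<omega> \<in> ?A \<union> ?B" by (subst (asm) prob_eq_1) auto
  then show ?thesis by eventually_elim auto
qed

lemma nn_integral_exp_rademacher_le:
  assumes "n \<ge> 1"
  shows "(\<integral>\<^sup>+\<omega>. ennreal (exp (l * \<epsilon> n \<omega>)) \<partial>M) \<le> ennreal (exp (l\<^sup>2 / 2))"
proof -
  let ?A = "{\<omega> \<in> space M. \<epsilon> n \<omega> = 1}" and ?B = "{\<omega> \<in> space M. \<epsilon> n \<omega> = -1}"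
  have [measurable]: "?A \<in> events" "?B \<in> events"
    using measurable_rademacher[OF assms] by measurable
  define h :: real where "h = 1 / 2"
  have h: "h \<ge> 0" by (simp add: h_def)
  have em: "emeasure M ?A = ennreal h" "emeasure M ?B = ennreal h"
    using rademacher assms by (simp_all only: emeasure_eq_measure rademacher_seq_def h_def)
  have "(\<integral>\<^sup>+\<omega>. ennreal (exp (l * \<epsilon> n \<omega>)) \<partial>M) =
    (\<integral>\<^sup>+\<omega>. ennreal (exp l) * indicator ?A \<omega> + ennreal (exp (-l)) * indicator ?B \<omega> \<partial>M)"
  proof (rule nn_integral_cong_AE)
    show "AE \<omega> in M. ennreal (exp (l * \<epsilon> n \<omega>)) =
      ennreal (exp l) * indicator ?A \<omega> + ennreal (exp (-l)) * indicator ?B \<omega>"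
      using AE_rademacher[OF assms] AE_space by eventually_elim (auto simp: indicator_def)
  qed
  also have "\<dots> = ennreal (exp l) * ennreal h + ennreal (exp (-l)) * ennreal h"
    by (simp add: nn_integral_add nn_integral_cmult_indicator em)
  also have "\<dots> = ennreal (exp l * h + exp (-l) * h)"
    using h by (simp flip: ennreal_mult ennreal_plus)
  also have "exp l * h + exp (-l) * h = cosh l"
    by (simp add: h_def cosh_def add_divide_distrib)
  also have "\<dots> \<le> ennreal (exp (l\<^sup>2 / 2))"
    by (intro ennreal_leI cosh_le_exp_square)
  finally show ?thesis .
qed

lemma nn_integral_exp_sum_le:
  assumes "finite B" "B \<subseteq> {1..}" "(\<Sum>n\<in>B. (r n)\<^sup>2) \<le> v"
  shows "(\<integral>\<^sup>+\<omega>. ennreal (exp (l * (\<Sum>n\<in>B. r n * \<epsilon> n \<omega>))) \<partial>M) \<le> ennreal (exp (l\<^sup>2 * v / 2))"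
proof -
  have "(\<integral>\<^sup>+\<omega>. ennreal (exp (l * (\<Sum>n\<in>B. r n * \<epsilon> n \<omega>))) \<partial>M) =
    (\<integral>\<^sup>+\<omega>. (\<Prod>n\<in>B. ennreal (exp (l * r n * \<epsilon> n \<omega>))) \<partial>M)"
    using assms by (simp add: prod_ennreal sum_distrib_left exp_sum mult.assoc)
  also have "\<dots> = (\<Prod>n\<in>B. \<integral>\<^sup>+\<omega>. ennreal (exp (l * r n * \<epsilon> n \<omega>)) \<partial>M)"
    using assms
    by (intro indep_vars_nn_integral
        indep_vars_compose2[OF indep_vars_subset[OF indep], where Y = "\<lambda>n x. ennreal (exp (l * r n * x))"]) auto
  also have "\<dots> \<le> (\<Prod>n\<in>B. ennreal (exp ((l * r n)\<^sup>2 / 2)))"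
    using assms by (intro prod_mono_ennreal nn_integral_exp_rademacher_le) auto
  also have "\<dots> = ennreal (exp (l\<^sup>2 * (\<Sum>n\<in>B. (r n)\<^sup>2) / 2))"
    using assms by (simp add: prod_ennreal exp_sum[symmetric] sum_distrib_left sum_divide_distrib power_mult_distrib)
  also have "\<dots> \<le> ennreal (exp (l\<^sup>2 * v / 2))"
    using assms by (intro ennreal_leI) (auto intro!: mult_left_mono divide_right_mono)
  finally show ?thesis .
qed

text \<open>The modulus is at most the sum of the absolute real and imaginary parts. These are
  dependent, so they are separated by the arithmetic-geometric mean inequality at the price of
  doubling the parameter. Opening the absolute values leaves half of a sum of four real exponential
  moments, each at most \<open>exp (2 * \<mu>\<^sup>2 * v)\<close>.\<close>

lemma nn_integral_exp_cmod_sum_le: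
  fixes c :: "nat \<Rightarrow> complex"
  assumes B: "finite B" "B \<subseteq> {1..}" and v: "(\<Sum>n\<in>B. (cmod (c n))\<^sup>2) \<le> v" and \<mu>: "\<mu> \<ge> 0"
  shows "(\<integral>\<^sup>+\<omega>. ennreal (exp (\<mu> * cmod (\<Sum>n\<in>B. c n * of_real (\<epsilon> n \<omega>)))) \<partial>M) \<le> ennreal (2 * exp (2 * \<mu>\<^sup>2 * v))"
proof -
  define X where "X \<omega> = (\<Sum>n\<in>B. Re (c n) * \<epsilon> n \<omega>)" for \<omega>
  define Y where "Y \<omega> = (\<Sum>n\<in>B. Im (c n) * \<epsilon> n \<omega>)" for \<omega>
  have [measurable]: "X \<in> borel_measurable M" "Y \<in> borel_measurable M"
    unfolding X_def Y_def using B by (auto intro!: borel_measurable_sum borel_measurable_times)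
  define h :: real where "h = 1 / 2"
  have h: "h \<ge> 0" by (simp add: h_def)
  have pt: "exp (\<mu> * cmod (\<Sum>n\<in>B. c n * of_real (\<epsilon> n \<omega>)))
     \<le> h * (exp ((2*\<mu>) * X \<omega>) + exp (-(2*\<mu>) * X \<omega>) + (exp ((2*\<mu>) * Y \<omega>) + exp (-(2*\<mu>) * Y \<omega>)))" for \<omega>
  proof -
    have abs: "exp (2 * \<mu> * \<bar>x\<bar>) \<le> exp ((2*\<mu>) * x) + exp (-(2*\<mu>) * x)" for x :: real
      by (cases "x \<ge> 0") auto
    have "cmod (\<Sum>n\<in>B. c n * of_real (\<epsilon> n \<omega>)) \<le> \<bar>X \<omega>\<bar> + \<bar>Y \<omega>\<bar>"
      using cmod_le[of "\<Sum>n\<in>B. c n * of_real (\<epsilon> n \<omega>)"] by (simp add: X_def Y_def)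
    then have "exp (\<mu> * cmod (\<Sum>n\<in>B. c n * of_real (\<epsilon> n \<omega>))) \<le> exp (\<mu> * \<bar>X \<omega>\<bar> + \<mu> * \<bar>Y \<omega>\<bar>)"
      using \<mu> mult_left_mono[OF _ \<mu>] by (fastforce simp: distrib_left[symmetric])
    also have "\<dots> = exp (\<mu> * \<bar>X \<omega>\<bar>) * exp (\<mu> * \<bar>Y \<omega>\<bar>)" by (rule exp_add)
    also have "\<dots> \<le> (exp (\<mu> * \<bar>X \<omega>\<bar>) ^ 2 + exp (\<mu> * \<bar>Y \<omega>\<bar>) ^ 2) / 2"
      using sum_squares_bound[of "exp (\<mu> * \<bar>X \<omega>\<bar>)" "exp (\<mu> * \<bar>Y \<omega>\<bar>)"] by simp
    also have "\<dots> = h * (exp (2 * \<mu> * \<bar>X \<omega>\<bar>) + exp (2 * \<mu> * \<bar>Y \<omega>\<bar>))"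
      by (simp add: exp_double mult.assoc h_def)
    also have "\<dots> \<le> h * (exp ((2*\<mu>) * X \<omega>) + exp (-(2*\<mu>) * X \<omega>) + (exp ((2*\<mu>) * Y \<omega>) + exp (-(2*\<mu>) * Y \<omega>)))"
      by (intro mult_left_mono add_mono abs h)
    finally show ?thesis .
  qed
  have bX: "(\<integral>\<^sup>+\<omega>. ennreal (exp (l * X \<omega>)) \<partial>M) \<le> ennreal (exp (l\<^sup>2 * v / 2))" for l
    unfolding X_def by (intro nn_integral_exp_sum_le B order_trans[OF _ v] sum_mono) (auto simp: cmod_power2)
  have bY: "(\<integral>\<^sup>+\<omega>. ennreal (exp (l * Y \<omega>)) \<partial>M) \<le> ennreal (exp (l\<^sup>2 * v / 2))" for l
    unfolding Y_def by (intro nn_integral_exp_sum_le B order_trans[OF _ v] sum_mono) (auto simp: cmod_power2)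
  have "(\<integral>\<^sup>+\<omega>. ennreal (exp (\<mu> * cmod (\<Sum>n\<in>B. c n * of_real (\<epsilon> n \<omega>)))) \<partial>M) \<le>
    (\<integral>\<^sup>+\<omega>. ennreal h * (ennreal (exp ((2*\<mu>) * X \<omega>)) + ennreal (exp (-(2*\<mu>) * X \<omega>)) +
      (ennreal (exp ((2*\<mu>) * Y \<omega>)) + ennreal (exp (-(2*\<mu>) * Y \<omega>)))) \<partial>M)"
    by (intro nn_integral_mono) (use pt h in \<open>simp flip: ennreal_plus ennreal_mult\<close>)
  also have "\<dots> = ennreal h * ((\<integral>\<^sup>+\<omega>. ennreal (exp ((2*\<mu>) * X \<omega>)) \<partial>M) + (\<integral>\<^sup>+\<omega>. ennreal (exp (-(2*\<mu>) * X \<omega>)) \<partial>M) +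
      ((\<integral>\<^sup>+\<omega>. ennreal (exp ((2*\<mu>) * Y \<omega>)) \<partial>M) + (\<integral>\<^sup>+\<omega>. ennreal (exp (-(2*\<mu>) * Y \<omega>)) \<partial>M)))"
    by (simp add: nn_integral_cmult nn_integral_add)
  also have "\<dots> \<le> ennreal h * (ennreal (exp ((2*\<mu>)\<^sup>2 * v / 2)) + ennreal (exp ((-(2*\<mu>))\<^sup>2 * v / 2)) +
      (ennreal (exp ((2*\<mu>)\<^sup>2 * v / 2)) + ennreal (exp ((-(2*\<mu>))\<^sup>2 * v / 2))))"
    by (intro mult_left_mono add_mono bX bY) auto
  also have "\<dots> = ennreal (h * (4 * exp (2 * \<mu>\<^sup>2 * v)))"
    using h by (simp add: power_mult_distrib flip: ennreal_plus ennreal_mult)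
  also have "h * (4 * exp (2 * \<mu>\<^sup>2 * v)) = 2 * exp (2 * \<mu>\<^sup>2 * v)"
    by (simp add: h_def)
  finally show ?thesis .
qed

text \<open>The constant factor \<open>2\<close> above, raised to the number of groups, would cost a factor
  \<open>sqrt (ln N)\<close> in the end; here the bound tends to \<open>1\<close> with \<open>\<mu>\<close>.\<close>

lemma nn_integral_exp_cmod_sum_le_linear:
  fixes c :: "nat \<Rightarrow> complex"
  assumes B: "finite B" "B \<subseteq> {1..}" and v: "(\<Sum>n\<in>B. (cmod (c n))\<^sup>2) \<le> v" "v > 0" and \<mu>: "\<mu> \<ge> 0"
  shows "(\<integral>\<^sup>+\<omega>. ennreal (exp (\<mu> * cmod (\<Sum>n\<in>B. c n * of_real (\<epsilon> n \<omega>)))) \<partial>M)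
    \<le> ennreal (exp (18 * \<mu> * sqrt v + 3 * \<mu>\<^sup>2 * v))"
proof -
  define Z where "Z \<omega> = cmod (\<Sum>n\<in>B. c n * of_real (\<epsilon> n \<omega>))" for \<omega>
  define s where "s = \<mu> * sqrt v"
  have s0: "s \<ge> 0" using \<mu> v by (simp add: s_def)
  have s2: "s\<^sup>2 = \<mu>\<^sup>2 * v" using v by (simp add: s_def power_mult_distrib)
  have [measurable]: "Z \<in> borel_measurable M"
  proof -
    have [measurable]: "\<epsilon> n \<in> borel_measurable M" if "n \<in> B" for n
      using B that by (intro measurable_rademacher) auto
    show ?thesis unfolding Z_def by measurable
  qed
  have e2: "exp 2 \<le> (9::real)"
    using exp_le power_mono[of "exp 1 :: real" 3 2] by (simp add: exp_of_nat_mult[symmetric])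
  have "(\<integral>\<^sup>+\<omega>. ennreal (exp (\<mu> * Z \<omega>)) \<partial>M) \<le> ennreal (exp (18 * s + 3 * s\<^sup>2))"
  proof (cases "s \<le> 1")
    case True
    \<comment> \<open>convexity interpolates between the exponents \<open>0\<close> and \<open>1 / sqrt v\<close>\<close>
    have conv: "exp (s * x) \<le> (1 - s) + s * exp x" for x :: real
    proof -
      have "convex_on UNIV (exp :: real \<Rightarrow> real)" by (rule exp_convex)
      from convex_onD[OF this, of s 0 x] show ?thesis using s0 True by simp
    qed
    have "(\<integral>\<^sup>+\<omega>. ennreal (exp (\<mu> * Z \<omega>)) \<partial>M) \<le> (\<integral>\<^sup>+\<omega>. ennreal (1 - s) + ennreal s * ennreal (exp (1 / sqrt v * Z \<omega>)) \<partial>M)"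
    proof (intro nn_integral_mono)
      fix \<omega>
      have "exp (\<mu> * Z \<omega>) = exp (s * (1 / sqrt v * Z \<omega>))" using v by (simp add: s_def)
      also have "\<dots> \<le> (1 - s) + s * exp (1 / sqrt v * Z \<omega>)" by (rule conv)
      finally show "ennreal (exp (\<mu> * Z \<omega>)) \<le> ennreal (1 - s) + ennreal s * ennreal (exp (1 / sqrt v * Z \<omega>))"
        using s0 True by (simp flip: ennreal_plus ennreal_mult)
    qed
    also have "\<dots> = ennreal (1 - s) + ennreal s * (\<integral>\<^sup>+\<omega>. ennreal (exp (1 / sqrt v * Z \<omega>)) \<partial>M)"
      by (simp add: nn_integral_add nn_integral_cmult emeasure_space_1)
    \<comment> \<open>At the parameter \<open>1 / sqrt v\<close> the previous bound is the absolute
      constant \<open>2 * exp 2\<close>, which is at most \<open>18\<close> by \<open>e2\<close>;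
      this is where the coefficient 18 comes from.\<close>
    also have "\<dots> \<le> ennreal (1 - s) + ennreal s * ennreal (2 * exp (2 * (1 / sqrt v)\<^sup>2 * v))"
      unfolding Z_def using v by (intro add_mono mult_left_mono nn_integral_exp_cmod_sum_le B) auto
    also have "\<dots> = ennreal ((1 - s) + s * (2 * exp 2))"
      using s0 True v by (simp add: power_divide flip: ennreal_plus ennreal_mult)
    also have "\<dots> \<le> ennreal (exp (18 * s + 3 * s\<^sup>2))"
    proof (rule ennreal_leI)
      have "(1 - s) + s * (2 * exp 2) \<le> 1 + s * 18"
        using mult_left_mono[OF e2 s0] s0 by simp
      also have "\<dots> \<le> 1 + (18 * s + 3 * s\<^sup>2)" by simp
      also have "\<dots> \<le> exp (18 * s + 3 * s\<^sup>2)" by (rule exp_ge_add_one_self)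
      finally show "(1 - s) + s * (2 * exp 2) \<le> exp (18 * s + 3 * s\<^sup>2)" .
    qed
    finally show ?thesis .
  next
    case False
    have "(\<integral>\<^sup>+\<omega>. ennreal (exp (\<mu> * Z \<omega>)) \<partial>M) \<le> ennreal (2 * exp (2 * \<mu>\<^sup>2 * v))"
      unfolding Z_def by (intro nn_integral_exp_cmod_sum_le B v \<mu>)
    also have "\<dots> \<le> ennreal (exp (18 * s + 3 * s\<^sup>2))"
    proof (rule ennreal_leI)
      \<comment> \<open>For \<open>s > 1\<close> the linear term in the exponent is already large
        enough to absorb the factor 2.\<close>
      have "2 \<le> exp (1::real)" using exp_ge_add_one_self[of "1::real"] by simp
      also have "\<dots> \<le> exp (18 * s)" using False by simp
      finally have "2 * exp (2 * \<mu>\<^sup>2 * v) \<le> exp (18 * s) * exp (2 * \<mu>\<^sup>2 * v)" by simp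
      also have "\<dots> = exp (18 * s + 2 * s\<^sup>2)" by (simp add: s2 exp_add)
      also have "\<dots> \<le> exp (18 * s + 3 * s\<^sup>2)" by simp
      finally show "2 * exp (2 * \<mu>\<^sup>2 * v) \<le> exp (18 * s + 3 * s\<^sup>2)" .
    qed
    finally show ?thesis .
  qed
  then show ?thesis by (simp add: Z_def s_def s2[unfolded s_def] mult.assoc)
qed

text \<open>Different values of \<open>g\<close> select disjoint blocks of indices, so the moduli of
  the block sums are independent and the moment factors over \<open>G\<close>. The linear bound is
  applied to each block; its leading term adds up to the sum of the standard deviations.\<close>

lemma nn_integral_exp_sum_cmod_le:
  fixes c :: "nat \<Rightarrow> complex" and g :: "nat \<Rightarrow> 'b"
  assumes B: "finite B" "B \<subseteq> {1..}" and G: "finite G"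
    and v: "\<And>u. u \<in> G \<Longrightarrow> (\<Sum>n | n \<in> B \<and> g n = u. (cmod (c n))\<^sup>2) \<le> v u" "\<And>u. u \<in> G \<Longrightarrow> v u > 0" and \<mu>: "\<mu> \<ge> 0"
  shows "(\<integral>\<^sup>+\<omega>. ennreal (exp (\<mu> * (\<Sum>u\<in>G. cmod (\<Sum>n | n \<in> B \<and> g n = u. c n * of_real (\<epsilon> n \<omega>))))) \<partial>M)
    \<le> ennreal (exp (18 * \<mu> * (\<Sum>u\<in>G. sqrt (v u)) + 3 * \<mu>\<^sup>2 * (\<Sum>u\<in>G. v u)))"
proof -
  define K where "K u = {n \<in> B. g n = u}" for u
  have K: "finite (K u)" "K u \<subseteq> {1..}" for u using B by (auto simp: K_def)
  define F where "F u x = ennreal (exp (\<mu> * cmod (\<Sum>n\<in>K u. c n * of_real (x n))))" for u and x :: "nat \<Rightarrow> real"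
  have "indep_vars (\<lambda>u. PiM (K u) (\<lambda>_. borel)) (\<lambda>u \<omega>. restrict (\<lambda>i. \<epsilon> i \<omega>) (K u)) G"
    using K by (intro indep_vars_restrict[OF indep]) (auto simp: disjoint_family_on_def K_def)
  moreover have "F u \<in> borel_measurable (PiM (K u) (\<lambda>_. borel))" for u
    unfolding F_def by measurable
  ultimately have "indep_vars (\<lambda>_. borel) (\<lambda>u \<omega>. F u (restrict (\<lambda>i. \<epsilon> i \<omega>) (K u))) G"
    by (rule indep_vars_compose2)
  also have "(\<lambda>u \<omega>. F u (restrict (\<lambda>i. \<epsilon> i \<omega>) (K u))) = (\<lambda>u \<omega>. F u (\<lambda>i. \<epsilon> i \<omega>))"
    by (intro ext) (simp add: F_def)
  finally have ind: "indep_vars (\<lambda>_. borel) (\<lambda>u \<omega>. F u (\<lambda>i. \<epsilon> i \<omega>)) G" .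
  have "(\<integral>\<^sup>+\<omega>. ennreal (exp (\<mu> * (\<Sum>u\<in>G. cmod (\<Sum>n\<in>K u. c n * of_real (\<epsilon> n \<omega>))))) \<partial>M) =
      (\<integral>\<^sup>+\<omega>. (\<Prod>u\<in>G. F u (\<lambda>i. \<epsilon> i \<omega>)) \<partial>M)"
    using G by (simp add: F_def prod_ennreal sum_distrib_left exp_sum)
  also have "\<dots> = (\<Prod>u\<in>G. \<integral>\<^sup>+\<omega>. F u (\<lambda>i. \<epsilon> i \<omega>) \<partial>M)"
    by (intro indep_vars_nn_integral G ind) auto
  also have "\<dots> \<le> (\<Prod>u\<in>G. ennreal (exp (18 * \<mu> * sqrt (v u) + 3 * \<mu>\<^sup>2 * v u)))"
    unfolding F_def using v by (intro prod_mono_ennreal nn_integral_exp_cmod_sum_le_linear K \<mu>) (auto simp: K_def)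
  also have "\<dots> = ennreal (exp (18 * \<mu> * (\<Sum>u\<in>G. sqrt (v u)) + 3 * \<mu>\<^sup>2 * (\<Sum>u\<in>G. v u)))"
    using G by (simp add: prod_ennreal exp_sum[symmetric] sum.distrib sum_distrib_left)
  finally show ?thesis by (simp add: K_def)
qed

end

section \<open>Discretization in \<open>t\<close>\<close>

text \<open>A chord is no longer than its arc: the squared chord is
  \<open>4 * (sin ((x - y) / 2))\<^sup>2\<close>.\<close>

lemma cmod_cis_diff_le: "cmod (cis x - cis y) \<le> \<bar>x - y\<bar>"
proof (rule power2_le_imp_le)
  have "(cmod (cis x - cis y))\<^sup>2 = (cos x - cos y)\<^sup>2 + (sin x - sin y)\<^sup>2"
    by (simp add: cmod_power2)
  also have "\<dots> = ((sin x)\<^sup>2 + (cos x)\<^sup>2) + ((sin y)\<^sup>2 + (cos y)\<^sup>2) - 2 * cos (x - y)"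
    by (simp add: cos_diff power2_eq_square algebra_simps del: sin_cos_squared_add sin_cos_squared_add2 sin_cos_squared_add3)
  also have "\<dots> = 4 * (sin ((x - y) / 2))\<^sup>2"
  proof -
    have "2 * ((x - y) / 2) = x - y" by simp
    then have "cos (x - y) = 1 - 2 * (sin ((x - y) / 2))\<^sup>2"
      using cos_double_sin[of "(x - y) / 2"] by metis
    then show ?thesis by simp
  qed
  also have "\<dots> \<le> 4 * ((x - y) / 2)\<^sup>2"
    using abs_sin_x_le_abs_x[of "(x - y) / 2"] by (simp flip: abs_le_square_iff)
  also have "\<dots> = \<bar>x - y\<bar>\<^sup>2" by (simp add: power_divide)
  finally show "(cmod (cis x - cis y))\<^sup>2 \<le> \<bar>x - y\<bar>\<^sup>2" .
qed simp

lemma cis_near_root_of_unity: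
  assumes "N > 0"
  obtains k where "k < N" "cmod (cis x - cis (2 * pi * real k / real N)) \<le> 2 * pi / real N"
proof -
  \<comment> \<open>The angle is measured in full turns and rounded down to a multiple of
    \<open>1 / N\<close>; passing to the fractional part keeps the index below
    \<open>N\<close>.\<close>
  define y where "y = frac (x / (2 * pi))"
  have y: "0 \<le> y" "y < 1" by (simp_all add: y_def frac_lt_1)
  have "x = 2 * pi * y + 2 * pi * of_int \<lfloor>x / (2 * pi)\<rfloor>"
    by (simp add: y_def frac_def field_simps)
  then have "cis x = cis (2 * pi * y) * cis (2 * pi * of_int \<lfloor>x / (2 * pi)\<rfloor>)"
    by (metis cis_mult)
  then have cis: "cis x = cis (2 * pi * y)" by (simp add: cis_multiple_2pi)
  define k where "k = nat \<lfloor>real N * y\<rfloor>"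
  have k: "real k \<le> real N * y" "real N * y < real k + 1"
    using y by (simp_all add: k_def)
  have "real N * y < real N" using y assms by simp
  then have "k < N" using k by linarith
  moreover have "cmod (cis x - cis (2 * pi * real k / real N)) \<le> 2 * pi / real N"
  proof -
    have "cmod (cis x - cis (2 * pi * real k / real N)) \<le> \<bar>2 * pi * y - 2 * pi * real k / real N\<bar>"
      unfolding cis by (rule cmod_cis_diff_le)
    also have "2 * pi * y - 2 * pi * real k / real N = 2 * pi / real N * (real N * y - real k)"
      using assms by (simp add: field_simps)
    also have "\<bar>\<dots>\<bar> = 2 * pi / real N * \<bar>real N * y - real k\<bar>"
      by (simp add: abs_mult)
    also have "\<dots> \<le> 2 * pi / real N * 1" using k by (intro mult_left_mono) auto
    finally show ?thesis by simp
  qed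
  ultimately show thesis by (rule that)
qed

lemma cmod_unimodular_mult_diff_le:
  assumes "cmod z' = 1" "cmod w = 1"
  shows "cmod (z * z' - w * w') \<le> cmod (z - w) + cmod (z' - w')"
proof -
  have "z * z' - w * w' = (z - w) * z' + w * (z' - w')" by (simp add: algebra_simps)
  then show ?thesis
    using norm_triangle_ineq[of "(z - w) * z'" "w * (z' - w')"] assms by (simp add: norm_mult)
qed

lemma of_nat_powr_eq_cis:
  assumes "n > 0"
  shows "of_nat n powr (- of_real \<sigma> - \<i> * of_real t) = of_real (real n powr (-\<sigma>)) * cis (- t * ln (real n))"
proof -
  have "of_nat n powr (- of_real \<sigma> - \<i> * of_real t) = exp (of_real (- \<sigma> * ln (real n)) + \<i> * of_real (- t * ln (real n)))"
    using assms by (simp add: powr_def Ln_of_nat algebra_simps)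
  also have "\<dots> = of_real (real n powr (-\<sigma>)) * cis (- t * ln (real n))"
    using assms unfolding exp_add cis_conv_exp by (simp add: powr_def exp_of_real flip: exp_of_real)
  finally show ?thesis .
qed

text \<open>\<open>k m\<close> is the index of the \<open>N\<close>-th root of unity that stands in
  for \<open>m\<close> to the power \<open>-it\<close>, so the product stands in for the phase of
  \<open>a * b\<close> and no longer contains \<open>t\<close>.\<close>

definition root_product :: "nat \<Rightarrow> (nat \<Rightarrow> nat) \<Rightarrow> nat \<Rightarrow> nat \<Rightarrow> complex" where
  "root_product N k a b = cis (2 * pi * real (k a) / real N) * cis (2 * pi * real (k b) / real N)"

text \<open>The phase of \<open>u n\<close> is common to its whole group and disappears under the
  modulus. The phases of \<open>a n\<close> and \<open>b n\<close> are rounded, which costs at most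
  \<open>4 * pi / N\<close> for each of fewer than \<open>N\<close> terms with coefficients of
  modulus at most 1. The witness \<open>k\<close> depends on \<open>t\<close>, but it ranges over a
  finite set that depends on neither \<open>t\<close> nor the signs.\<close>

lemma dirichlet_poly_le_net:
  fixes \<epsilon> :: "nat \<Rightarrow> real" and u a b :: "nat \<Rightarrow> nat"
  assumes \<sigma>: "\<sigma> \<ge> 0" and N: "N \<ge> 2" and G: "finite G"
    and fac: "\<And>n. n \<in> {2..N} \<Longrightarrow> n = u n * a n * b n \<and> u n \<in> G \<and> a n \<in> {1..Y} \<and> b n \<in> {1..Y}"
    and \<epsilon>: "\<And>n. n \<in> {2..N} \<Longrightarrow> \<bar>\<epsilon> n\<bar> \<le> 1"
  shows "\<exists>k\<in>PiE {1..Y} (\<lambda>_. {..<N}). cmod (dirichlet_poly \<sigma> \<epsilon> N t) \<le>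
    (\<Sum>v\<in>G. cmod (\<Sum>n | n \<in> {2..N} \<and> u n = v. (of_real (real n powr (-\<sigma>)) * root_product N k (a n) (b n)) * of_real (\<epsilon> n))) + 4 * pi"
proof -
  have "\<exists>k<N. cmod (cis (-t * ln (real m)) - cis (2 * pi * real k / real N)) \<le> 2 * pi / real N" for m :: nat
    using cis_near_root_of_unity[of N "-t * ln (real m)"] N by force
  then obtain k' where k': "\<And>m. k' m < N"
    "\<And>m::nat. cmod (cis (-t * ln (real m)) - cis (2 * pi * real (k' m) / real N)) \<le> 2 * pi / real N"
    by metis
  \<comment> \<open>Only the values on \<open>{1..Y}\<close> are ever read; cutting off the rest
    places \<open>k\<close> in a set of \<open>N ^ Y\<close> functions.\<close>
  define k where "k = restrict k' {1..Y}"
  have k: "k \<in> PiE {1..Y} (\<lambda>_. {..<N})" using k' by (auto simp: k_def)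
  define w where "w n = cis (-t * ln (real (a n))) * cis (-t * ln (real (b n)))" for n
  define w' where "w' n = root_product N k (a n) (b n)" for n
  define c where "c n = of_real (real n powr (-\<sigma>)) * of_real (\<epsilon> n) * cis (-t * ln (real (u n)))" for n
  have ww: "cmod (w n - w' n) \<le> 4 * pi / real N" if "n \<in> {2..N}" for n
  proof -
    have ab: "a n \<in> {1..Y}" "b n \<in> {1..Y}" using fac[OF that] by auto
    have "cmod (w n - w' n) \<le> 2 * pi / real N + 2 * pi / real N"
      unfolding w_def w'_def root_product_def using ab k'(2)[of "a n"] k'(2)[of "b n"]
      by (intro order_trans[OF cmod_unimodular_mult_diff_le] add_mono) (auto simp: k_def)
    then show ?thesis by simp
  qed
  have c1: "cmod (c n) \<le> 1" if "n \<in> {2..N}" for n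
  proof -
    have "real n powr (-\<sigma>) \<le> real n powr 0" using that \<sigma> by (intro powr_mono) auto
    then have "real n powr (-\<sigma>) \<le> 1" using that by simp
    then show ?thesis using \<epsilon>[OF that]
      by (auto simp: c_def norm_mult intro!: mult_le_one)
  qed
  have "dirichlet_poly \<sigma> \<epsilon> N t = (\<Sum>n=2..N. c n * w n)"
    unfolding dirichlet_poly_def
  proof (rule sum.cong[OF refl])
    fix n assume n: "n \<in> {2..N}"
    note f = fac[OF n]
    have pos: "u n > 0" "a n > 0" "b n > 0" using f n by (auto intro!: Nat.gr0I)
    have "ln (real n) = ln (real (u n * a n * b n))" using f by simp
    also have "\<dots> = ln (real (u n)) + ln (real (a n)) + ln (real (b n))"
      using pos by (simp add: ln_mult)
    finally have "- t * ln (real n) = - t * ln (real (u n)) + (- t * ln (real (a n)) + - t * ln (real (b n)))"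
      by (simp add: algebra_simps)
    then have "cis (- t * ln (real n)) = cis (- t * ln (real (u n))) * w n"
      by (simp only: w_def cis_mult[symmetric])
    then show "of_real (\<epsilon> n) * of_nat n powr (- of_real \<sigma> - \<i> * of_real t) = c n * w n"
      using n by (subst of_nat_powr_eq_cis) (auto simp: c_def)
  qed
  also have "\<dots> = (\<Sum>n=2..N. c n * w' n) + (\<Sum>n=2..N. c n * (w n - w' n))"
    by (simp add: algebra_simps flip: sum.distrib)
  also have "cmod \<dots> \<le> cmod (\<Sum>n=2..N. c n * w' n) + cmod (\<Sum>n=2..N. c n * (w n - w' n))"
    by (rule norm_triangle_ineq)
  also have "cmod (\<Sum>n=2..N. c n * (w n - w' n)) \<le> (\<Sum>n=2..N. 1 * (4 * pi / real N))"
    unfolding norm_mult using c1 ww by (intro sum_norm_le) (metis norm_mult mult_mono norm_ge_zero zero_le_one)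
  also have "\<dots> = real (N - 1) * (4 * pi / real N)" by simp
  also have "\<dots> \<le> real N * (4 * pi / real N)" by (intro mult_right_mono) auto
  also have "\<dots> = 4 * pi" using N by simp
  also have "(\<Sum>n=2..N. c n * w' n) = (\<Sum>v\<in>G. \<Sum>n | n \<in> {2..N} \<and> u n = v. c n * w' n)"
    using fac G by (intro sum.group[symmetric]) auto
  also have "cmod \<dots> \<le> (\<Sum>v\<in>G. cmod (\<Sum>n | n \<in> {2..N} \<and> u n = v. c n * w' n))"
    by (rule norm_sum)
  also have "\<dots> = (\<Sum>v\<in>G. cmod (\<Sum>n | n \<in> {2..N} \<and> u n = v. (of_real (real n powr (-\<sigma>)) * w' n) * of_real (\<epsilon> n)))"
  proof (rule sum.cong[OF refl])
    fix v assume "v \<in> G"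
    have "(\<Sum>n | n \<in> {2..N} \<and> u n = v. c n * w' n) =
      cis (-t * ln (real v)) * (\<Sum>n | n \<in> {2..N} \<and> u n = v. (of_real (real n powr (-\<sigma>)) * w' n) * of_real (\<epsilon> n))"
      unfolding sum_distrib_left by (intro sum.cong) (auto simp: c_def)
    then show "cmod (\<Sum>n | n \<in> {2..N} \<and> u n = v. c n * w' n) =
      cmod (\<Sum>n | n \<in> {2..N} \<and> u n = v. (of_real (real n powr (-\<sigma>)) * w' n) * of_real (\<epsilon> n))"
      by (simp add: norm_mult)
  qed
  finally have "cmod (dirichlet_poly \<sigma> \<epsilon> N t) \<le>
    (\<Sum>v\<in>G. cmod (\<Sum>n | n \<in> {2..N} \<and> u n = v. (of_real (real n powr (-\<sigma>)) * w' n) * of_real (\<epsilon> n))) + 4 * pi"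
    by simp
  then show ?thesis using k unfolding w'_def by blast
qed

section \<open>Variances of the groups and the resulting exponent\<close>

lemma sum_multiples_powr_le:
  fixes \<sigma> :: real
  assumes \<sigma>: "0 \<le> \<sigma>" "\<sigma> < 1 / 2" and v: "v \<ge> 1" and A: "A \<subseteq> {1..N}" "\<And>n. n \<in> A \<Longrightarrow> v dvd n"
  shows "(\<Sum>n\<in>A. (real n powr (-\<sigma>))\<^sup>2) \<le> real N powr (1 - 2 * \<sigma>) / (1 - 2 * \<sigma>) * inverse (real v)"
proof -
  have "A \<subseteq> (\<lambda>m. v * m) ` {1..N div v}"
  proof
    fix n assume n: "n \<in> A"
    then obtain m where m: "n = v * m" using A(2) by blast
    have "n \<in> {1..N}" using A n by auto
    moreover from this have "m \<le> N div v" using m v by (simp add: less_eq_div_iff_mult_less_eq mult.commute)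
    ultimately have "m \<in> {1..N div v}" using m by (cases m) auto
    then show "n \<in> (\<lambda>m. v * m) ` {1..N div v}" using m by blast
  qed
  then have "(\<Sum>n\<in>A. (real n powr (-\<sigma>))\<^sup>2) \<le> (\<Sum>n\<in>(\<lambda>m. v * m) ` {1..N div v}. (real n powr (-\<sigma>))\<^sup>2)"
    by (intro sum_mono2) auto
  also have "\<dots> = (\<Sum>m=1..N div v. (real (v * m) powr (-\<sigma>))\<^sup>2)"
    using v by (subst sum.reindex) (auto simp: inj_on_def)
  also have "\<dots> = (\<Sum>m=1..N div v. real v powr (- (2 * \<sigma>)) * real m powr (- (2 * \<sigma>)))"
    using v by (intro sum.cong) (auto simp: powr_mult power_mult_distrib powr_power mult.commute)
  also have "\<dots> = real v powr (- (2 * \<sigma>)) * (\<Sum>m=1..N div v. real m powr (- (2 * \<sigma>)))"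
    by (simp add: sum_distrib_left)
  \<comment> \<open>The condition \<open>\<sigma> < 1 / 2\<close> enters here: it makes the exponent
    \<open>2 * \<sigma>\<close> smaller than 1.\<close>
  also have "\<dots> \<le> real v powr (- (2 * \<sigma>)) * (real (N div v) powr (1 - 2 * \<sigma>) / (1 - 2 * \<sigma>))"
    using \<sigma> by (intro mult_left_mono sum_powr_le) auto
  also have "\<dots> \<le> real v powr (- (2 * \<sigma>)) * ((real N / real v) powr (1 - 2 * \<sigma>) / (1 - 2 * \<sigma>))"
    using \<sigma> by (intro mult_left_mono divide_right_mono powr_mono2 of_nat_div_le_of_nat) auto
  also have "\<dots> = real N powr (1 - 2 * \<sigma>) / (1 - 2 * \<sigma>) * inverse (real v)"
    using v by (simp add: powr_divide powr_diff powr_minus field_simps)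
  finally show ?thesis .
qed

text \<open>\<open>w v\<close> bounds the variance of group \<open>v\<close>, and
  \<open>\<mu>\<close> is \<open>L\<close> divided by the normalization of the theorem. The sum of
  the standard deviations has the order of that normalization, by the prime sum, so the linear term
  has order exactly \<open>L\<close>. The quadratic term has order \<open>sqrt N\<close> up to
  logarithms and is estimated crudely. The exponent \<open>3 / 4\<close> in \<open>L\<close> is one
  choice between \<open>1 / 2\<close>, which the logarithmic size of the net must not exceed, and
  \<open>1\<close>, above which the quadratic term would dominate.\<close>

lemma group_exponent_le:
  fixes \<sigma> :: real
  assumes \<sigma>: "0 \<le> \<sigma>" "\<sigma> < 1 / 2" and N: "N \<ge> 2"
  defines "G \<equiv> insert 1 {p. prime p \<and> p \<le> N}"
  defines "w \<equiv> \<lambda>v. real N powr (1 - 2 * \<sigma>) / (1 - 2 * \<sigma>) * inverse (real v)"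
  defines "L \<equiv> real N powr (3 / 4)"
  defines "\<mu> \<equiv> L / (real N powr (1 - \<sigma>) * inverse (ln (real N)))"
  shows "18 * \<mu> * (\<Sum>v\<in>G. sqrt (w v)) + 3 * \<mu>\<^sup>2 * (\<Sum>v\<in>G. w v)
    \<le> (396 / sqrt (1 - 2 * \<sigma>) + 6144 / (1 - 2 * \<sigma>)) * L"
proof -
  define x where "x = real N"
  define d where "d = 1 - 2 * \<sigma>"
  have d: "d > 0" using \<sigma> by (simp add: d_def)
  have x: "x \<ge> 2" using N by (simp add: x_def)
  have lnx: "ln x > 0" using x by simp
  have \<mu>: "\<mu> = x powr (\<sigma> - 1 / 4) * ln x"
    using x lnx by (simp add: \<mu>_def L_def x_def field_simps flip: powr_add powr_diff)
  have \<mu>0: "\<mu> \<ge> 0" using \<mu> lnx by simp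
  have fin: "finite {p::nat. prime p \<and> p \<le> N}" by (rule finite_subset[of _ "{..N}"]) auto
  have "(\<Sum>v\<in>G. real v powr (-1/2)) = 1 + (\<Sum>p | prime p \<and> p \<le> N. real p powr (-1/2))"
    unfolding G_def using fin by (subst sum.insert) auto
  \<comment> \<open>The group \<open>v = 1\<close> contributes 1, which is absorbed through
    \<open>ln x \<le> 2 * sqrt x\<close>.\<close>
  also have "\<dots> \<le> 2 * sqrt x / ln x + 20 * sqrt x / ln x"
    using sum_inverse_sqrt_primes_le[OF N] ln_le_powr[of x "1/2"] x lnx
    by (intro add_mono) (auto simp: x_def powr_half_sqrt field_simps)
  finally have s1: "(\<Sum>v\<in>G. real v powr (-1/2)) \<le> 22 * sqrt x / ln x" by (simp add: field_simps)
  have w1: "sqrt (w v) = x powr (1 / 2 - \<sigma>) / sqrt d * real v powr (-1/2)" for v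
  proof -
    have "sqrt (x powr (1 - 2 * \<sigma>)) = x powr (1 / 2 - \<sigma>)"
      by (simp add: powr_powr diff_divide_distrib flip: powr_half_sqrt)
    moreover have "sqrt (inverse (real v)) = real v powr (-1/2)"
      by (simp add: powr_minus real_sqrt_inverse powr_half_sqrt)
    ultimately show ?thesis by (simp add: w_def real_sqrt_mult real_sqrt_divide d_def x_def)
  qed
  have "18 * \<mu> * (\<Sum>v\<in>G. sqrt (w v)) = 18 * \<mu> * (x powr (1 / 2 - \<sigma>) / sqrt d) * (\<Sum>v\<in>G. real v powr (-1/2))"
    by (simp add: w1 sum_distrib_left mult.assoc)
  also have "\<dots> \<le> 18 * \<mu> * (x powr (1 / 2 - \<sigma>) / sqrt d) * (22 * sqrt x / ln x)"
    using s1 \<mu>0 d by (intro mult_left_mono) auto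
  also have "\<dots> = 396 / sqrt d * (x powr (\<sigma> - 1 / 4) * x powr (1 / 2 - \<sigma>) * x powr (1 / 2))"
    using lnx x d by (simp add: \<mu> powr_half_sqrt field_simps)
  also have "x powr (\<sigma> - 1 / 4) * x powr (1 / 2 - \<sigma>) * x powr (1 / 2) = L"
    by (simp add: L_def x_def flip: powr_add)
  finally have A: "18 * \<mu> * (\<Sum>v\<in>G. sqrt (w v)) \<le> 396 / sqrt d * L" .
  have "(\<Sum>v\<in>G. inverse (real v)) \<le> (\<Sum>v=1..N. inverse (real v))"
    using N by (intro sum_mono2) (auto simp: G_def dest: prime_ge_1_nat)
  \<comment> \<open>The power \<open>7/8\<close> makes \<open>sum_powr_le\<close> applicable and
    costs \<open>x powr (1/8)\<close>. The squared logarithm below costs another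
    \<open>x powr (1/8)\<close>, and with the remaining \<open>x powr (1/2)\<close> this gives
    exactly \<open>L\<close>.\<close>
  also have "\<dots> \<le> (\<Sum>v=1..N. real v powr (-(7/8)))"
  proof (rule sum_mono)
    fix v assume "v \<in> {1..N}"
    then have v: "real v \<ge> 1" by simp
    then have "real v powr (-1) \<le> real v powr (-(7/8))" by (intro powr_mono) auto
    then show "inverse (real v) \<le> real v powr (-(7/8))" using v by (simp add: powr_minus)
  qed
  also have "\<dots> \<le> x powr (1 / 8) * 8"
    using sum_powr_le[of "7/8" N] by (simp add: x_def)
  finally have s2: "(\<Sum>v\<in>G. inverse (real v)) \<le> x powr (1 / 8) * 8" .
  have "3 * \<mu>\<^sup>2 * (\<Sum>v\<in>G. w v) = 3 * \<mu>\<^sup>2 * (x powr (1 - 2 * \<sigma>) / d) * (\<Sum>v\<in>G. inverse (real v))"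
    by (simp add: w_def sum_distrib_left mult.assoc x_def d_def)
  also have "\<dots> \<le> 3 * \<mu>\<^sup>2 * (x powr (1 - 2 * \<sigma>) / d) * (x powr (1 / 8) * 8)"
    using s2 d by (intro mult_left_mono) auto
  also have "\<dots> = 24 / d * (x powr (2 * \<sigma> - 1 / 2) * x powr (1 - 2 * \<sigma>) * x powr (1 / 8)) * (ln x)\<^sup>2"
    using x by (simp add: \<mu> power_mult_distrib powr_power left_diff_distrib mult_ac)
  also have "x powr (2 * \<sigma> - 1 / 2) * x powr (1 - 2 * \<sigma>) * x powr (1 / 8) = x powr (5 / 8)"
    by (simp flip: powr_add)
  also have "24 / d * x powr (5 / 8) * (ln x)\<^sup>2 \<le> 24 / d * x powr (5 / 8) * (16 * x powr (1 / 16))\<^sup>2"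
    using ln_le_powr[of x "1/16"] x d lnx by (intro mult_left_mono power_mono) auto
  also have "\<dots> = 6144 / d * (x powr (5 / 8) * x powr (1 / 8))"
    using x by (simp add: power_mult_distrib powr_power)
  also have "x powr (5 / 8) * x powr (1 / 8) = L"
    by (simp add: L_def x_def flip: powr_add)
  finally have B: "3 * \<mu>\<^sup>2 * (\<Sum>v\<in>G. w v) \<le> 6144 / d * L" .
  show ?thesis using A B unfolding d_def by (simp add: distrib_right)
qed

section \<open>The supremum over \<open>N\<close>\<close>

text \<open>The first two summands are the coefficient from \<open>group_exponent_le\<close>. The
  last is 32 for the rounding error, 8 for the logarithmic size of the net, and 1 that is left over
  to make the excess decay like \<open>exp (- L)\<close>.\<close>

definition tail_const :: "real \<Rightarrow> real" where
  "tail_const \<sigma> = 396 / sqrt (1 - 2 * \<sigma>) + 6144 / (1 - 2 * \<sigma>) + 41"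

text \<open>In place of a union bound for probabilities, \<open>g\<close> is an additive majorant of
  the excess over the constant: the maximum over the net is replaced by a sum of exponentials over
  the net. One \<open>g\<close> serves all \<open>t\<close>, and the bounds on its expectation are
  summable over \<open>N\<close>.\<close>

lemma (in rademacher_space) level_bound:
  fixes \<sigma> :: real
  assumes \<sigma>: "0 \<le> \<sigma>" "\<sigma> < 1 / 2" and N: "N \<ge> 2"
  obtains g :: "'a \<Rightarrow> ennreal" where "g \<in> borel_measurable M"
    "AE \<omega> in M. \<forall>t. ennreal (cmod (dirichlet_poly \<sigma> (\<lambda>n. \<epsilon> n \<omega>) N t) / (real N powr (1 - \<sigma>) * inverse (ln (real N))))
       \<le> ennreal (tail_const \<sigma>) + g \<omega>"
    "(\<integral>\<^sup>+\<omega>. g \<omega> \<partial>M) \<le> ennreal (real N powr (-3/2))"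
proof -
  define Y where "Y = nat \<lceil>sqrt (real N)\<rceil>"
  have "sqrt (real N) \<le> real Y" by (simp add: Y_def)
  then have "sqrt (real N) ^ 2 \<le> real Y ^ 2" by (intro power_mono) auto
  then have Y2: "N \<le> Y\<^sup>2" by (simp flip: of_nat_power)
  have Yle: "real Y \<le> 2 * sqrt (real N)"
  proof -
    have "real Y \<le> sqrt (real N) + 1"
      using of_int_ceiling_le_add_one[of "sqrt (real N)"] by (simp add: Y_def)
    moreover have "1 \<le> sqrt (real N)" using N by simp
    ultimately show ?thesis by linarith
  qed
  define G where "G = insert 1 {p::nat. prime p \<and> p \<le> N}"
  have finG: "finite G"
    unfolding G_def by (intro finite.insertI finite_subset[of "{p::nat. prime p \<and> p \<le> N}" "{..N}"]) auto
  have Gpos: "v \<ge> 1" if "v \<in> G" for v using that by (auto simp: G_def dest: prime_ge_1_nat)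
  have "\<exists>u a b. n = u * a * b \<and> u \<in> G \<and> a \<in> {1..Y} \<and> b \<in> {1..Y}" if "n \<in> {2..N}" for n
  proof -
    have n: "1 \<le> n" "n \<le> N" using that by auto
    obtain u a b where "n = u * a * b" "u = 1 \<or> prime u" "1 \<le> u" "u \<le> N" "1 \<le> a" "a \<le> Y" "1 \<le> b" "b \<le> Y"
      by (rule prime_times_two_small_factors[OF n Y2])
    then show ?thesis by (intro exI[of _ u] exI[of _ a] exI[of _ b]) (auto simp: G_def)
  qed
  then obtain u a b where fac: "\<And>n. n \<in> {2..N} \<Longrightarrow>
    n = u n * a n * b n \<and> u n \<in> G \<and> a n \<in> {1..Y} \<and> b n \<in> {1..Y}"
    by metis
  define F where "F = PiE {1..Y} (\<lambda>_. {..<N})"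
  have finF: "finite F" unfolding F_def by (intro finite_PiE) auto
  have cardF: "real (card F) = real N ^ Y" by (simp add: F_def card_PiE)
  define c where "c k n = of_real (real n powr (-\<sigma>)) * root_product N k (a n) (b n)" for k n
  define S where "S k \<omega> = (\<Sum>v\<in>G. cmod (\<Sum>n | n \<in> {2..N} \<and> u n = v. c k n * of_real (\<epsilon> n \<omega>)))" for k \<omega>
  define x where "x = real N"
  have x: "x \<ge> 2" using N by (simp add: x_def)
  define D where "D = x powr (1 - \<sigma>) * inverse (ln x)"
  define L where "L = x powr (3 / 4)"
  define \<mu> where "\<mu> = L / D"
  define K where "K = tail_const \<sigma>"
  have lnx: "ln x > 0" using x by simp
  have Dpos: "D > 0" using x lnx by (simp add: D_def)
  have Lpos: "L > 0" using x by (simp add: L_def)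
  have \<mu>: "\<mu> \<ge> 0" using Dpos Lpos by (simp add: \<mu>_def)
  \<comment> \<open>A lower bound for the normalization that is uniform in \<open>N\<close>, so that
    the rounding error \<open>4 * pi\<close> contributes at most 32 to the ratio.\<close>
  have D2: "D \<ge> 1 / 2"
  proof -
    have "ln x \<le> 2 * x powr (1 / 2)" using ln_le_powr[of x "1/2"] x by simp
    also have "\<dots> \<le> 2 * x powr (1 - \<sigma>)" using x \<sigma> by (intro mult_left_mono powr_mono) auto
    finally show ?thesis using lnx by (simp add: D_def field_simps)
  qed
  define e where "e = exp (- (L * (K - 32))) / L"
  have e: "e \<ge> 0" using Lpos by (simp add: e_def)
  define g where "g \<omega> = ennreal e * (\<Sum>k\<in>F. ennreal (exp (\<mu> * S k \<omega>)))" for \<omega>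
  have S_meas [measurable]: "S k \<in> borel_measurable M" for k
  proof -
    have [measurable]: "\<epsilon> n \<in> borel_measurable M" if "n \<in> {n \<in> {2..N}. u n = v}" for n v
      using that by (intro measurable_rademacher) auto
    show ?thesis unfolding S_def by measurable
  qed
  have g_meas: "g \<in> borel_measurable M" unfolding g_def by measurable
  moreover have "AE \<omega> in M. \<forall>t. ennreal (cmod (dirichlet_poly \<sigma> (\<lambda>n. \<epsilon> n \<omega>) N t) / D) \<le> ennreal K + g \<omega>"
  proof -
    have "AE \<omega> in M. \<forall>n\<in>{2..N}. \<epsilon> n \<omega> = 1 \<or> \<epsilon> n \<omega> = -1"
      by (intro AE_finite_allI AE_rademacher) auto
    then show ?thesis
    proof (eventually_elim, intro allI)
      fix \<omega> t
      assume "\<forall>n\<in>{2..N}. \<epsilon> n \<omega> = 1 \<or> \<epsilon> n \<omega> = -1"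
      then have eps: "\<bar>\<epsilon> n \<omega>\<bar> \<le> 1" if "n \<in> {2..N}" for n using that by fastforce
      obtain k where k: "k \<in> F" "cmod (dirichlet_poly \<sigma> (\<lambda>n. \<epsilon> n \<omega>) N t) \<le> S k \<omega> + 4 * pi"
        using dirichlet_poly_le_net[of \<sigma> N G u a b Y "\<lambda>n. \<epsilon> n \<omega>" t, OF \<sigma>(1) N finG fac eps]
        by (auto simp: F_def S_def c_def)
      define R where "R = cmod (dirichlet_poly \<sigma> (\<lambda>n. \<epsilon> n \<omega>) N t) / D"
      have "R \<le> (S k \<omega> + 4 * pi) / D"
        unfolding R_def using k Dpos by (intro divide_right_mono) auto
      also have "\<dots> = S k \<omega> / D + 4 * pi / D" by (simp add: add_divide_distrib)
      also have "4 * pi / D \<le> 4 * pi / (1 / 2)" using D2 by (intro divide_left_mono) auto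
      also have "\<dots> \<le> 32" using pi_less_4 by simp
      finally have R: "R \<le> S k \<omega> / D + 32" by simp
      \<comment> \<open>The inequality \<open>y \<le> exp y\<close> at
        \<open>y = L * (R - K)\<close>, divided by \<open>L\<close>, bounds the excess
        \<open>R - K\<close> by an exponential; this explains the factor \<open>1 / L\<close> in
        \<open>e\<close>.\<close>
      have "L * (R - K) \<le> exp (L * (R - K))"
        using exp_ge_add_one_self[of "L * (R - K)"] by linarith
      also have "\<dots> \<le> exp (L * (S k \<omega> / D + 32 - K))" using R Lpos by simp
      also have "\<dots> = exp (\<mu> * S k \<omega>) * exp (- (L * (K - 32)))"
        by (simp add: \<mu>_def algebra_simps flip: exp_add)
      finally have "R \<le> K + e * exp (\<mu> * S k \<omega>)"
        using Lpos by (simp add: e_def field_simps)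
      then have "ennreal R \<le> ennreal (K + e * exp (\<mu> * S k \<omega>))" by (rule ennreal_leI)
      also have "\<dots> = ennreal K + ennreal e * ennreal (exp (\<mu> * S k \<omega>))"
        using e \<sigma> by (subst ennreal_plus) (auto simp: K_def tail_const_def ennreal_mult)
      also have "\<dots> \<le> ennreal K + g \<omega>"
        unfolding g_def using k finF by (intro add_left_mono mult_left_mono member_le_sum) auto
      finally show "ennreal (cmod (dirichlet_poly \<sigma> (\<lambda>n. \<epsilon> n \<omega>) N t) / D) \<le> ennreal K + g \<omega>"
        by (simp add: R_def)
    qed
  qed
  moreover have "(\<integral>\<^sup>+\<omega>. g \<omega> \<partial>M) \<le> ennreal (x powr (-3/2))"
  proof -
    define w where "w v = x powr (1 - 2 * \<sigma>) / (1 - 2 * \<sigma>) * inverse (real v)" for v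
    define E where "E = 18 * \<mu> * (\<Sum>v\<in>G. sqrt (w v)) + 3 * \<mu>\<^sup>2 * (\<Sum>v\<in>G. w v)"
    have E: "E \<le> (K - 41) * L"
      using group_exponent_le[OF \<sigma> N]
      unfolding E_def G_def w_def \<mu>_def L_def D_def x_def K_def tail_const_def by simp
    have w_pos: "w v > 0" if "v \<in> G" for v using Gpos[OF that] x \<sigma> by (simp add: w_def)
    have variance: "(\<Sum>n | n \<in> {2..N} \<and> u n = v. (cmod (c k n))\<^sup>2) \<le> w v" if "v \<in> G" for k v
    proof -
      have "(\<Sum>n | n \<in> {2..N} \<and> u n = v. (cmod (c k n))\<^sup>2) = (\<Sum>n | n \<in> {2..N} \<and> u n = v. (real n powr (-\<sigma>))\<^sup>2)"
        by (simp add: c_def root_product_def norm_mult)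
      also have "\<dots> \<le> w v"
        unfolding w_def x_def using Gpos[OF that] fac
        by (intro sum_multiples_powr_le \<sigma>) (auto intro: dvdI simp: mult.assoc)
      finally show ?thesis .
    qed
    have "(\<integral>\<^sup>+\<omega>. ennreal (exp (\<mu> * S k \<omega>)) \<partial>M) \<le> ennreal (exp E)" for k
      unfolding S_def E_def using variance w_pos
      by (intro nn_integral_exp_sum_cmod_le finG \<mu>) auto
    moreover have "(\<integral>\<^sup>+\<omega>. g \<omega> \<partial>M) = ennreal e * (\<Sum>k\<in>F. \<integral>\<^sup>+\<omega>. ennreal (exp (\<mu> * S k \<omega>)) \<partial>M)"
      unfolding g_def by (simp add: nn_integral_cmult nn_integral_sum del: sum_ennreal)
    ultimately have "(\<integral>\<^sup>+\<omega>. g \<omega> \<partial>M) \<le> ennreal e * (\<Sum>k\<in>F. ennreal (exp E))"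
      by (simp only:) (intro mult_left_mono sum_mono, auto)
    also have "\<dots> = ennreal (e * (real N ^ Y * exp E))"
      using e by (simp add: ennreal_mult ennreal_of_nat_eq_real_of_nat flip: cardF)
    also have "\<dots> \<le> ennreal (x powr (-3/2))"
    proof (rule ennreal_leI)
      have "real N ^ Y = exp (real Y * ln x)"
        using x by (simp add: x_def exp_of_nat_mult)
      moreover have "real Y * ln x \<le> 8 * L"
      proof -
        have "real Y * ln x \<le> (2 * x powr (1 / 2)) * (4 * x powr (1 / 4))"
          using Yle ln_le_powr[of x "1/4"] x lnx by (intro mult_mono) (auto simp: x_def powr_half_sqrt)
        also have "\<dots> = 8 * L" by (simp add: L_def flip: powr_add)
        finally show ?thesis .
      qed
      ultimately have "e * (real N ^ Y * exp E) \<le> e * (exp (8 * L) * exp ((K - 41) * L))"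
        using E e by (intro mult_left_mono mult_mono) auto
      also have "\<dots> = exp (- L) / L"
        by (simp add: e_def algebra_simps flip: exp_add)
      \<comment> \<open>Polynomial decay is enough: \<open>L\<close> to the power \<open>-2\<close>
        is \<open>x powr (-3/2)\<close>, which is summable.\<close>
      also have "\<dots> \<le> (1 / L) / L"
      proof (intro divide_right_mono)
        have "L \<le> exp L" using exp_ge_add_one_self[of L] by linarith
        then show "exp (- L) \<le> 1 / L" using Lpos by (simp add: exp_minus field_simps)
      qed (use Lpos in simp)
      also have "\<dots> = x powr (-3/2)"
        using x by (simp add: L_def powr_minus_divide flip: powr_add)
      finally show "e * (real N ^ Y * exp E) \<le> x powr (-3/2)" .
    qed
    finally show ?thesis .
  qed
  ultimately show thesis
    by (intro that[of g]) (simp_all only: D_def K_def x_def)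
qed

text \<open>The supremum over \<open>N\<close> of the excesses is at most their series, whose
  integral is computed term by term. The comparison with the series is monotonicity of the integral,
  so measurability of \<open>sup_ratio\<close> is never at issue.\<close>

lemma (in rademacher_space) nn_integral_sup_ratio_le:
  assumes \<sigma>: "0 \<le> \<sigma>" "\<sigma> < 1 / 2"
  shows "(\<integral>\<^sup>+\<omega>. sup_ratio \<sigma> (\<lambda>n. \<epsilon> n \<omega>) \<partial>M) \<le> ennreal (tail_const \<sigma> + (\<Sum>N. real N powr (-3/2)))"
proof -
  define R where "R N \<omega> t = ennreal (cmod (dirichlet_poly \<sigma> (\<lambda>n. \<epsilon> n \<omega>) N t) /
    (real N powr (1 - \<sigma>) * inverse (ln (real N))))" for N \<omega> t
  define P where "P N g \<longleftrightarrow> g \<in> borel_measurable M \<and> (N \<ge> 2 \<longrightarrow> (AE \<omega> in M. \<forall>t. R N \<omega> t \<le> ennreal (tail_const \<sigma>) + g \<omega>)) \<and>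
    (\<integral>\<^sup>+\<omega>. g \<omega> \<partial>M) \<le> ennreal (real N powr (-3/2))" for N g
  have "\<exists>g. P N g" for N
  proof (cases "N \<ge> 2")
    case True
    show ?thesis by (rule level_bound[OF \<sigma> True]) (auto simp: P_def R_def)
  next
    case False
    \<comment> \<open>The levels below 2 do not occur in the supremum; the zero function only fills
      their places in the series.\<close>
    show ?thesis by (rule exI[of _ "\<lambda>_. 0"]) (use False in \<open>auto simp: P_def\<close>)
  qed
  then obtain g where "\<And>N. P N (g N)" by metis
  then have g: "\<And>N. g N \<in> borel_measurable M"
    "\<And>N. N \<ge> 2 \<Longrightarrow> AE \<omega> in M. \<forall>t. R N \<omega> t \<le> ennreal (tail_const \<sigma>) + g N \<omega>"
    "\<And>N. (\<integral>\<^sup>+\<omega>. g N \<omega> \<partial>M) \<le> ennreal (real N powr (-3/2))"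
    unfolding P_def by blast+
  note g(1)[measurable]
  have summ: "summable (\<lambda>N. real N powr (-3/2))" by (simp add: summable_real_powr_iff)
  have "AE \<omega> in M. \<forall>N\<in>{2..}. \<forall>t. R N \<omega> t \<le> ennreal (tail_const \<sigma>) + g N \<omega>"
    using g(2) by (intro AE_ball_countable') auto
  then have "AE \<omega> in M. sup_ratio \<sigma> (\<lambda>n. \<epsilon> n \<omega>) \<le> ennreal (tail_const \<sigma>) + (\<Sum>N. g N \<omega>)"
  proof eventually_elim
    fix \<omega> assume *: "\<forall>N\<in>{2..}. \<forall>t. R N \<omega> t \<le> ennreal (tail_const \<sigma>) + g N \<omega>"
    have "g N \<omega> \<le> (\<Sum>N. g N \<omega>)" for N
      using sum_le_suminf[of "\<lambda>N. g N \<omega>" "{N}"] by simp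
    then show "sup_ratio \<sigma> (\<lambda>n. \<epsilon> n \<omega>) \<le> ennreal (tail_const \<sigma>) + (\<Sum>N. g N \<omega>)"
      unfolding sup_ratio_def R_def[symmetric] using *
      by (intro SUP_least) (meson add_left_mono order_trans)
  qed
  then have "(\<integral>\<^sup>+\<omega>. sup_ratio \<sigma> (\<lambda>n. \<epsilon> n \<omega>) \<partial>M) \<le> (\<integral>\<^sup>+\<omega>. ennreal (tail_const \<sigma>) + (\<Sum>N. g N \<omega>) \<partial>M)"
    by (rule nn_integral_mono_AE)
  also have "\<dots> = ennreal (tail_const \<sigma>) + (\<Sum>N. \<integral>\<^sup>+\<omega>. g N \<omega> \<partial>M)"
    by (subst nn_integral_add) (simp_all add: emeasure_space_1 nn_integral_suminf)
  also have "\<dots> \<le> ennreal (tail_const \<sigma>) + (\<Sum>N. ennreal (real N powr (-3/2)))"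
    by (intro add_left_mono suminf_le g) auto
  also have "(\<Sum>N. ennreal (real N powr (-3/2))) = ennreal (\<Sum>N. real N powr (-3/2))"
    by (intro suminf_ennreal2 summ) auto
  also have "ennreal (tail_const \<sigma>) + \<dots> = ennreal (tail_const \<sigma> + (\<Sum>N. real N powr (-3/2)))"
    using \<sigma> by (intro ennreal_plus[symmetric] suminf_nonneg summ) (auto simp: tail_const_def)
  finally show ?thesis .
qed

text \<open>At \<open>N = 2\<close> the polynomial is a single term of modulus
  \<open>2 powr (-\<sigma>)\<close> almost surely. Dividing by the normalization cancels
  \<open>\<sigma>\<close> and leaves \<open>ln 2 / 2\<close>.\<close>

lemma (in rademacher_space) nn_integral_sup_ratio_ge:
  "ennreal (ln 2 / 2) \<le> (\<integral>\<^sup>+\<omega>. sup_ratio \<sigma> (\<lambda>n. \<epsilon> n \<omega>) \<partial>M)"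
proof -
  have "AE \<omega> in M. ennreal (ln 2 / 2) \<le> sup_ratio \<sigma> (\<lambda>n. \<epsilon> n \<omega>)"
    using AE_rademacher[of 2, simplified]
  proof eventually_elim
    fix \<omega> assume "\<epsilon> 2 \<omega> = 1 \<or> \<epsilon> 2 \<omega> = -1"
    then have "cmod (dirichlet_poly \<sigma> (\<lambda>n. \<epsilon> n \<omega>) 2 0) = 2 powr (-\<sigma>)"
      using of_nat_powr_eq_cis[of 2 \<sigma> 0] by (auto simp: dirichlet_poly_def norm_mult)
    then have "ln 2 / 2 = cmod (dirichlet_poly \<sigma> (\<lambda>n. \<epsilon> n \<omega>) 2 0) / (real 2 powr (1 - \<sigma>) * inverse (ln (real 2)))"
      by (simp add: powr_diff powr_minus field_simps)
    then show "ennreal (ln 2 / 2) \<le> sup_ratio \<sigma> (\<lambda>n. \<epsilon> n \<omega>)"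
      unfolding sup_ratio_def by (intro SUP_upper2[of 2] SUP_upper2[of 0]) auto
  qed
  then have "(\<integral>\<^sup>+\<omega>. ennreal (ln 2 / 2) \<partial>M) \<le> (\<integral>\<^sup>+\<omega>. sup_ratio \<sigma> (\<lambda>n. \<epsilon> n \<omega>) \<partial>M)"
    by (rule nn_integral_mono_AE)
  then show ?thesis by (simp add: emeasure_space_1)
qed

theorem mainTheorem3:
  fixes \<sigma> :: real
  assumes "0 \<le> \<sigma>" and "\<sigma> < 1 / 2"
  shows "\<exists>C::real. C > 0 \<and>
           (\<forall>(M :: 'a measure) \<epsilon>. rademacher_seq M \<epsilon> \<longrightarrow>
              ennreal (inverse C) \<le> (\<integral>\<^sup>+ \<omega>. sup_ratio \<sigma> (\<lambda>n. \<epsilon> n \<omega>) \<partial>M) \<and>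
              (\<integral>\<^sup>+ \<omega>. sup_ratio \<sigma> (\<lambda>n. \<epsilon> n \<omega>) \<partial>M) \<le> ennreal C)"
proof -
  define B where "B = tail_const \<sigma> + (\<Sum>N. real N powr (-3/2))"
  \<comment> \<open>The summand \<open>2 / ln 2\<close> puts \<open>inverse C\<close> below
    \<open>ln 2 / 2\<close>. Both summands are fixed before \<open>M\<close> and the signs are
    chosen, so \<open>C\<close> depends on \<open>\<sigma>\<close> alone.\<close>
  define C where "C = B + 2 / ln 2"
  have "0 \<le> tail_const \<sigma>" using assms by (simp add: tail_const_def)
  moreover have "0 \<le> (\<Sum>N. real N powr (-3/2))"
    by (intro suminf_nonneg) (auto simp: summable_real_powr_iff)
  ultimately have B: "B \<ge> 0" by (simp add: B_def)
  have C: "C \<ge> 2 / ln 2" "C \<ge> B" "C > 0" using B by (simp_all add: C_def add_nonneg_pos)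
  show ?thesis
  proof (intro exI[of _ C] conjI allI impI)
    show "C > 0" by fact
  next
    fix M :: "'a measure" and \<epsilon> assume *: "rademacher_seq M \<epsilon>"
    then interpret rademacher_space M \<epsilon>
      by (auto simp: rademacher_space_def rademacher_space_axioms_def rademacher_seq_def)
    have "inverse C \<le> inverse (2 / ln 2)" using C(1) by (intro le_imp_inverse_le) auto
    then have "ennreal (inverse C) \<le> ennreal (ln 2 / 2)" by (intro ennreal_leI) simp
    also have "\<dots> \<le> (\<integral>\<^sup>+ \<omega>. sup_ratio \<sigma> (\<lambda>n. \<epsilon> n \<omega>) \<partial>M)" by (rule nn_integral_sup_ratio_ge)
    finally show "ennreal (inverse C) \<le> (\<integral>\<^sup>+ \<omega>. sup_ratio \<sigma> (\<lambda>n. \<epsilon> n \<omega>) \<partial>M)" .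
    have "(\<integral>\<^sup>+ \<omega>. sup_ratio \<sigma> (\<lambda>n. \<epsilon> n \<omega>) \<partial>M) \<le> ennreal B"
      unfolding B_def by (rule nn_integral_sup_ratio_le[OF assms])
    also have "\<dots> \<le> ennreal C" using C by (intro ennreal_leI)
    finally show "(\<integral>\<^sup>+ \<omega>. sup_ratio \<sigma> (\<lambda>n. \<epsilon> n \<omega>) \<partial>M) \<le> ennreal C" .
  qed
qed

end
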